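(* There exist groups $G$ with a finite generating set $\mathcal G$ for which both of the following problems are algorithmically unsolvable: (Problem 1) given a geodesic word $u\in(\mathcal G^{\pm 1})^*$ and a generator $x\in\mathcal G$, decide whether $\ell(ux)-\ell(u)=0$, $1$ or $-1$; (Problem 2) given a geodesic word $u\in(\mathcal G^{\pm 1})^*$ and a generator $x\in\mathcal G$, decide whether $\ell(ux)>\ell(u)$.
   Context: For a word $w\in(\mathcal G^{\pm 1})^*$, $\ell(w)$ denotes the minimal length of a word in $(\mathcal G^{\pm 1})^*$ representing the same element of $G$ as $w$. A word $u$ is geodesic if its length equals $\ell(u)$. A problem is algorithmically unsolvable if there is no algorithm that returns the correct answer on every valid input (every pair $(u,x)$ with $u$ geodesic and $x\in\mathcal G$). *)

theory Defs
  imports "HOL-Algebra.Generated_Groups" "HOL-Library.Nat_Bijection"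
begin

(* Algorithms are programs for Kleene's partial recursive functions. Programs carry no
   arity: Zero and Proj accept argument lists of any suitable length, and a program applied
   to an argument list for which no rule fires diverges. In PrimRec and Mu the recursion or
   search variable is the first argument. *)

datatype recf =
    Zero
  | Succ
  | Proj nat
  | Comp recf "recf list"
  | PrimRec recf recf
  | Mu recf

inductive halts_with :: "recf \<Rightarrow> nat list \<Rightarrow> nat \<Rightarrow> bool" where
  Zero: "halts_with Zero xs 0"
| Succ: "halts_with Succ [x] (Suc x)"
| Proj: "i < length xs \<Longrightarrow> halts_with (Proj i) xs (xs ! i)"
| Comp: "list_all2 (\<lambda>g y. halts_with g xs y) gs ys \<Longrightarrow> halts_with f ys z
    \<Longrightarrow> halts_with (Comp f gs) xs z"
| PrimRec_0: "halts_with f xs y \<Longrightarrow> halts_with (PrimRec f g) (0 # xs) y"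
| PrimRec_Suc: "halts_with (PrimRec f g) (n # xs) r \<Longrightarrow> halts_with g (n # r # xs) y
    \<Longrightarrow> halts_with (PrimRec f g) (Suc n # xs) y"
| Mu: "halts_with f (n # xs) 0 \<Longrightarrow> (\<forall>m<n. \<exists>k. halts_with f (m # xs) (Suc k))
    \<Longrightarrow> halts_with (Mu f) xs n"

lemma halts_with_deterministic:
  "halts_with p xs y \<Longrightarrow> halts_with p xs z \<Longrightarrow> y = z"
proof (induction arbitrary: z rule: halts_with.induct)
  case (Zero xs)
  from Zero.prems show ?case by (cases rule: halts_with.cases) auto
next
  case (Succ x)
  from Succ.prems show ?case by (cases rule: halts_with.cases) auto
next
  case (Proj i xs)
  from Proj.prems show ?case by (cases rule: halts_with.cases) auto
next
  case (Comp xs gs ys f w)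
  from Comp.prems obtain ys' where *: "list_all2 (\<lambda>g y. halts_with g xs y) gs ys'"
      "halts_with f ys' z"
    by (cases rule: halts_with.cases) auto
  have len: "length ys = length gs" "length ys' = length gs"
    using list_all2_lengthD[OF Comp.IH(1)] list_all2_lengthD[OF *(1)] by simp_all
  have "ys = ys'"
  proof (rule nth_equalityI)
    show "length ys = length ys'" using len by simp
    fix i assume "i < length ys"
    with len have i: "i < length gs" by simp
    show "ys ! i = ys' ! i"
      using list_all2_nthD[OF Comp.IH(1) i] list_all2_nthD[OF *(1) i] by blast
  qed
  with Comp.IH(2) *(2) show ?case by blast
next
  case (PrimRec_0 f xs y g)
  from PrimRec_0.prems have "halts_with f xs z" by (cases rule: halts_with.cases) auto
  then show ?case by (rule PrimRec_0.IH)
next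
  case (PrimRec_Suc f g n xs r y)
  from PrimRec_Suc.prems obtain r' where
    "halts_with (PrimRec f g) (n # xs) r'" "halts_with g (n # r' # xs) z"
    by (cases rule: halts_with.cases) auto
  with PrimRec_Suc.IH show ?case by blast
next
  case (Mu f n xs)
  from Mu.prems have *: "halts_with f (z # xs) 0 \<and>
      (\<forall>m<z. \<exists>k. halts_with f (m # xs) (Suc k))"
    by (cases rule: halts_with.cases) simp_all
  show ?case
  proof (rule linorder_cases[of n z])
    assume "n < z"
    with * Mu.IH(1) show ?thesis by (metis nat.distinct(1))
  next
    assume "z < n"
    with * Mu.IH(2) show ?thesis by (metis nat.distinct(1))
  qed
qed

(* Nothing is required of the program outside the set of valid inputs; there it may diverge. *)
definition algorithmically_solvable ::
    "('i \<Rightarrow> nat list) \<Rightarrow> 'i set \<Rightarrow> ('i \<Rightarrow> nat) \<Rightarrow> bool" where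
  "algorithmically_solvable enc valid answer \<longleftrightarrow>
     (\<exists>p. \<forall>i\<in>valid. halts_with p (enc i) (answer i))"

(* A letter (x, True) stands for x and (x, False) for the formal inverse of x. *)
type_synonym 'a word = "('a \<times> bool) list"

definition words :: "'a set \<Rightarrow> 'a word set" where
  "words S = lists (S \<times> UNIV)"

definition word_value :: "('a, 'b) monoid_scheme \<Rightarrow> 'a word \<Rightarrow> 'a" where
  "word_value G w =
     foldr (\<lambda>(x, b) g. (if b then x else inv\<^bsub>G\<^esub> x) \<otimes>\<^bsub>G\<^esub> g) w \<one>\<^bsub>G\<^esub>"

definition ell :: "('a, 'b) monoid_scheme \<Rightarrow> 'a set \<Rightarrow> 'a word \<Rightarrow> nat" where
  "ell G S w = (LEAST n. \<exists>v\<in>words S. length v = n \<and> word_value G v = word_value G w)"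

definition geodesic :: "('a, 'b) monoid_scheme \<Rightarrow> 'a set \<Rightarrow> 'a word \<Rightarrow> bool" where
  "geodesic G S u \<longleftrightarrow> u \<in> words S \<and> length u = ell G S u"

definition valid_inputs :: "('a, 'b) monoid_scheme \<Rightarrow> 'a set \<Rightarrow> ('a word \<times> 'a) set" where
  "valid_inputs G S = {(u, x). geodesic G S u \<and> x \<in> S}"

definition encode_word :: "('a \<Rightarrow> nat) \<Rightarrow> 'a word \<Rightarrow> nat" where
  "encode_word num w = list_encode (map (\<lambda>(x, b). prod_encode (num x, of_bool b)) w)"

definition encode_input :: "('a \<Rightarrow> nat) \<Rightarrow> 'a word \<times> 'a \<Rightarrow> nat list" where
  "encode_input num = (\<lambda>(u, x). [encode_word num u, num x])"

(* Generators are presented to a program through a numbering of the finite set S. Any two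
   numberings differ by a permutation of a finite set, so solvability does not depend on the
   choice; the existential makes unsolvability a statement about all numberings. *)
definition solvable_for_generators ::
    "('a, 'b) monoid_scheme \<Rightarrow> 'a set \<Rightarrow> ('a word \<times> 'a \<Rightarrow> nat) \<Rightarrow> bool" where
  "solvable_for_generators G S answer \<longleftrightarrow>
     (\<exists>num. bij_betw num S {..<card S} \<and>
        algorithmically_solvable (encode_input num) (valid_inputs G S) answer)"

(* For x in S the difference is 0, 1 or -1 (lemma ell_append_generator), so deciding which
   of the three cases holds is computing the difference. *)
definition problem1_answer ::
    "('a, 'b) monoid_scheme \<Rightarrow> 'a set \<Rightarrow> 'a word \<times> 'a \<Rightarrow> nat" where
  "problem1_answer G S = (\<lambda>(u, x).
     int_encode (int (ell G S (u @ [(x, True)])) - int (ell G S u)))"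

definition problem2_answer ::
    "('a, 'b) monoid_scheme \<Rightarrow> 'a set \<Rightarrow> 'a word \<times> 'a \<Rightarrow> nat" where
  "problem2_answer G S = (\<lambda>(u, x). of_bool (ell G S (u @ [(x, True)]) > ell G S u))"

definition finite_generating_set :: "('a, 'b) monoid_scheme \<Rightarrow> 'a set \<Rightarrow> bool" where
  "finite_generating_set G S \<longleftrightarrow>
     finite S \<and> S \<subseteq> carrier G \<and> generate G S = carrier G"

lemma ell_le:
  assumes "v \<in> words S" "word_value G v = word_value G w"
  shows "ell G S w \<le> length v"
  unfolding ell_def by (rule Least_le) (use assms in blast)

lemma ell_attained:
  assumes "w \<in> words S"
  obtains v where "v \<in> words S" "length v = ell G S w" "word_value G v = word_value G w"
proof -
  have "\<exists>v\<in>words S. length v = ell G S w \<and> word_value G v = word_value G w"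
    unfolding ell_def by (rule LeastI[where k = "length w"]) (use assms in blast)
  then show thesis using that by blast
qed

context group
begin

lemma word_value_closed:
  "S \<subseteq> carrier G \<Longrightarrow> w \<in> words S \<Longrightarrow> word_value G w \<in> carrier G"
  by (induction w) (auto simp: words_def word_value_def)

lemma word_value_append:
  "S \<subseteq> carrier G \<Longrightarrow> v \<in> words S \<Longrightarrow> w \<in> words S
    \<Longrightarrow> word_value G (v @ w) = word_value G v \<otimes> word_value G w"
proof (induction v)
  case Nil
  then show ?case using word_value_closed[of S w] by (simp add: word_value_def)
next
  case (Cons a v)
  then have "v \<in> words S" "a \<in> S \<times> UNIV" by (auto simp: words_def)
  with Cons show ?case
    using word_value_closed[of S v] word_value_closed[of S w]
    by (auto simp: word_value_def m_assoc subset_iff split: prod.splits)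
qed

lemma ell_append_le:
  assumes S: "S \<subseteq> carrier G" and u: "u \<in> words S" and a: "[a] \<in> words S"
  shows "ell G S (u @ [a]) \<le> Suc (ell G S u)"
proof -
  obtain v where v: "v \<in> words S" "length v = ell G S u" "word_value G v = word_value G u"
    using ell_attained[OF u] by metis
  have "v @ [a] \<in> words S" using v a by (auto simp: words_def)
  moreover have "word_value G (v @ [a]) = word_value G (u @ [a])"
    using v u a S by (simp add: word_value_append)
  ultimately show ?thesis using v(2) ell_le[of "v @ [a]" S G] by simp
qed

lemma ell_append_generator:
  assumes S: "S \<subseteq> carrier G" and u: "u \<in> words S" and x: "x \<in> S"
  shows "int (ell G S (u @ [(x, True)])) - int (ell G S u) \<in> {0, 1, -1}"
proof -
  have l: "[(x, b)] \<in> words S" for b using x by (auto simp: words_def)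
  have ux: "u @ [(x, True)] \<in> words S" using u l by (auto simp: words_def)
  have xc: "x \<in> carrier G" using S x by blast
  have "word_value G ((u @ [(x, True)]) @ [(x, False)])
      = (word_value G u \<otimes> word_value G [(x, True)]) \<otimes> word_value G [(x, False)]"
    by (simp only: word_value_append[OF S ux l] word_value_append[OF S u l])
  also have "\<dots> = word_value G u \<otimes> x \<otimes> inv x"
    using xc by (simp add: word_value_def)
  also have "\<dots> = word_value G u"
    using xc word_value_closed[OF S u] by (simp add: m_assoc)
  finally have "ell G S ((u @ [(x, True)]) @ [(x, False)]) = ell G S u"
    by (simp add: ell_def)
  with ell_append_le[OF S ux l[of False]] ell_append_le[OF S u l[of True]]
  show ?thesis by auto
qed

end

end

theory Submission
  imports Defs "HOL-Library.Countable_Set"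
begin

text \<open>
  Solvability of either problem by a program and a numbering is a countable datum, so it suffices
  to give, for every set \<open>A\<close> of natural numbers, a two-generator group in which the answers to
  either problem determine \<open>A\<close>. Modify the lamplighter group: let the lamps no longer commute,
  the commutator of two lamps at distance \<open>n + 1\<close> being a central involution \<open>z\<^sub>n\<close>, and kill
  \<open>z\<^sub>n\<close> for \<open>n \<notin> A\<close>. With \<open>a\<close> the lamp switch and \<open>t\<close> the move, the word
  \<open>u = a t\<^sup>-\<^sup>N a t\<^sup>N\<close>, where \<open>N = n + 1\<close>, is geodesic since its image in the lamplighter group has
  two lit lamps at distance \<open>N\<close>. If \<open>n \<notin> A\<close>, then \<open>u a = t\<^sup>-\<^sup>N a t\<^sup>N\<close> is shorter than \<open>u\<close>.
  If \<open>n \<in> A\<close>, then \<open>u a = z\<^sub>n t\<^sup>-\<^sup>N a t\<^sup>N\<close>; a word for it needs \<open>2 N\<close> moves and an odd number of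
  switches, and a single switch does not produce \<open>z\<^sub>n\<close>, so \<open>u a\<close> is longer than \<open>u\<close>.
\<close>

section \<open>The modified lamplighter group as permutations of states\<close>

datatype gen = Switch | Move

instance gen :: countable
  by countable_datatype

text \<open>Lets \<open>from_nat\<close> enumerate all programs for the diagonal argument.\<close>

instance recf :: countable
  by countable_datatype

lemma UNIV_gen: "UNIV = {Switch, Move}"
  using gen.exhaust by auto

text \<open>
  A state consists of the position, the set of lit lamps and the exponents of the \<open>z\<^sub>m\<close>. Realising
  the generators as permutations of the states avoids checking a cocycle condition.
\<close>

type_synonym state = "int \<times> (int \<Rightarrow> bool) \<times> (nat \<Rightarrow> bool)"

text \<open>A switch at \<open>k\<close> consults the lit lamps to its right. So switching at
  \<open>k\<close> and at \<open>k + 1 + m\<close> in the two possible orders gives results that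
  differ exactly in exponent \<open>m\<close>, and only if \<open>m \<in> A\<close>; this is the
  commutator \<open>z\<^sub>m\<close>. A switch is an involution, hence its sign is ignored.\<close>

fun step :: "nat set \<Rightarrow> gen \<times> bool \<Rightarrow> state \<Rightarrow> state" where
  "step A (Switch, s) (k, F, Z) =
     (k, F(k := \<not> F k), \<lambda>m. Z m \<noteq> (m \<in> A \<and> F (k + 1 + int m)))"
| "step A (Move, s) (k, F, Z) = (if s then k + 1 else k - 1, F, Z)"

text \<open>The last letter acts first, so that concatenation becomes composition.\<close>

definition run :: "nat set \<Rightarrow> gen word \<Rightarrow> state \<Rightarrow> state" where
  "run A w = foldr (step A) w"

lemma run_Nil [simp]: "run A [] = id"
  and run_Cons [simp]: "run A (c # w) = step A c \<circ> run A w"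
  and run_append [simp]: "run A (v @ w) = run A v \<circ> run A w"
  by (simp_all add: run_def comp_def fun_eq_iff)

lemma step_inverse: "step A (g, \<not> s) \<circ> step A (g, s) = id"
proof
  fix x :: state
  obtain k F Z where x: "x = (k, F, Z)" by (cases x)
  show "(step A (g, \<not> s) \<circ> step A (g, s)) x = id x"
    by (cases g) (auto simp: x fun_eq_iff)
qed

definition inverse_word :: "'a word \<Rightarrow> 'a word" where
  "inverse_word w = rev (map (apsnd Not) w)"

lemma run_inverse_word: "run A (inverse_word w) \<circ> run A w = id"
proof (induction w)
  case (Cons c w)
  obtain g s where c: "c = (g, s)" by (cases c)
  have "run A (inverse_word (c # w)) \<circ> run A (c # w)
      = run A (inverse_word w) \<circ> (step A (g, \<not> s) \<circ> step A (g, s)) \<circ> run A w"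
    by (simp add: c inverse_word_def comp_assoc)
  also have "\<dots> = id" using Cons by (simp only: step_inverse comp_id)
  finally show ?case .
qed (simp add: inverse_word_def)

definition run_group :: "nat set \<Rightarrow> (state \<Rightarrow> state) monoid" where
  "run_group A = \<lparr>carrier = range (run A), mult = (\<circ>), one = id\<rparr>"

lemma group_run_group: "group (run_group A)"
proof (rule groupI)
  fix x y assume "x \<in> carrier (run_group A)" "y \<in> carrier (run_group A)"
  then obtain v w where "x = run A v" "y = run A w" by (auto simp: run_group_def)
  then show "x \<otimes>\<^bsub>run_group A\<^esub> y \<in> carrier (run_group A)"
    using run_append[of A v w, symmetric] by (auto simp: run_group_def simp del: run_append)
next
  fix x assume "x \<in> carrier (run_group A)"
  then obtain w where "x = run A w" by (auto simp: run_group_def)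
  then show "\<exists>y\<in>carrier (run_group A). y \<otimes>\<^bsub>run_group A\<^esub> x = \<one>\<^bsub>run_group A\<^esub>"
    using run_inverse_word[of A w] by (auto simp: run_group_def)
qed (auto simp: run_group_def comp_assoc intro: range_eqI[of _ _ "[]"])

section \<open>Transfer to a group on the natural numbers\<close>

lemma countable_group_iso_nat:
  fixes H :: "('a, 'b) monoid_scheme"
  assumes H: "group H" and c: "countable (carrier H)"
  obtains G :: "nat monoid" and \<phi> where "group G" "\<phi> \<in> iso H G"
proof -
  interpret H: group H by fact
  obtain \<phi> :: "'a \<Rightarrow> nat" where inj: "inj_on \<phi> (carrier H)"
    using c unfolding countable_def by blast
  define \<psi> where "\<psi> = inv_into (carrier H) \<phi>"
  have [simp]: "\<psi> (\<phi> x) = x" if "x \<in> carrier H" for x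
    using that inj by (simp add: \<psi>_def)
  define G :: "nat monoid" where
    "G = \<lparr>carrier = \<phi> ` carrier H, mult = \<lambda>x y. \<phi> (\<psi> x \<otimes>\<^bsub>H\<^esub> \<psi> y), one = \<phi> \<one>\<^bsub>H\<^esub>\<rparr>"
  have "group G"
  proof (rule groupI)
    fix x assume "x \<in> carrier G"
    then obtain a where a: "a \<in> carrier H" "x = \<phi> a" by (auto simp: G_def)
    then have "\<phi> (inv\<^bsub>H\<^esub> a) \<otimes>\<^bsub>G\<^esub> x = \<one>\<^bsub>G\<^esub>" by (simp add: G_def)
    moreover have "\<phi> (inv\<^bsub>H\<^esub> a) \<in> carrier G" using a by (simp add: G_def)
    ultimately show "\<exists>y\<in>carrier G. y \<otimes>\<^bsub>G\<^esub> x = \<one>\<^bsub>G\<^esub>" by blast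
  qed (auto simp: G_def H.m_assoc)
  moreover have "\<phi> \<in> iso H G"
    using inj by (auto simp: iso_def hom_def bij_betw_def G_def)
  ultimately show ?thesis by (rule that)
qed

definition relabel :: "('a \<Rightarrow> 'b) \<Rightarrow> 'a word \<Rightarrow> 'b word" where
  "relabel \<sigma> w = map (apfst \<sigma>) w"

lemma length_relabel [simp]: "length (relabel \<sigma> w) = length w"
  by (simp add: relabel_def)

lemma words_range: "words (range \<sigma>) = range (relabel \<sigma>)"
proof
  show "words (range \<sigma>) \<subseteq> range (relabel \<sigma>)"
  proof
    fix v assume "v \<in> words (range \<sigma>)"
    then have "set v \<subseteq> range (apfst \<sigma>)"
      by (force simp: words_def in_lists_conv_set image_def)
    then have "v \<in> range (map (apfst \<sigma>))"
      by (metis ex_map_conv rangeE range_eqI subsetD)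
    then show "v \<in> range (relabel \<sigma>)" by (auto simp: relabel_def)
  qed
qed (auto simp: words_def relabel_def in_lists_conv_set)

text \<open>Since \<open>\<phi>\<close> is injective, comparing word values in \<open>G\<close>
  amounts to comparing the permutations \<open>run A w\<close>.\<close>

lemma lamp_group_on_nat:
  obtains G :: "nat monoid" and \<sigma> :: "gen \<Rightarrow> nat" and \<phi> where
    "group G" "finite_generating_set G (range \<sigma>)" "inj_on \<phi> (range (run A))"
    "\<And>w. word_value G (relabel \<sigma> w) = \<phi> (run A w)"
proof -
  interpret H: group "run_group A" by (rule group_run_group)
  have "countable (carrier (run_group A))" by (simp add: run_group_def)
  with group_run_group obtain G :: "nat monoid" and \<phi> where G: "group G"
    and iso: "\<phi> \<in> iso (run_group A) G"
    by (rule countable_group_iso_nat)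
  interpret G: group G by fact
  interpret \<phi>: group_hom "run_group A" G \<phi>
    using iso by unfold_locales (simp add: iso_def)
  have inj: "inj_on \<phi> (range (run A))" and carr: "carrier G = \<phi> ` range (run A)"
    using iso by (auto simp: iso_def bij_betw_def run_group_def)
  have hom: "\<phi> (run A v \<circ> run A w) = \<phi> (run A v) \<otimes>\<^bsub>G\<^esub> \<phi> (run A w)" for v w
    using \<phi>.hom_mult[of "run A v" "run A w"] by (simp add: run_group_def)
  have one: "\<phi> id = \<one>\<^bsub>G\<^esub>"
    using \<phi>.hom_one by (simp add: run_group_def)
  have cl: "\<phi> (run A w) \<in> carrier G" for w by (simp add: carr)
  define \<sigma> where "\<sigma> g = \<phi> (run A [(g, True)])" for g
  have inv: "inv\<^bsub>G\<^esub> \<sigma> g = \<phi> (run A [(g, False)])" for g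
  proof (rule G.inv_equality)
    have "run A [(g, False)] \<circ> run A [(g, True)] = id"
      using step_inverse[of A g True] by simp
    then show "\<phi> (run A [(g, False)]) \<otimes>\<^bsub>G\<^esub> \<sigma> g = \<one>\<^bsub>G\<^esub>"
      unfolding \<sigma>_def hom[symmetric] by (simp only: one)
  qed (simp_all only: \<sigma>_def cl)
  have letter: "(if s then \<sigma> g else inv\<^bsub>G\<^esub> \<sigma> g) = \<phi> (run A [(g, s)])" for g s
    using inv[of g] by (cases s) (simp_all only: \<sigma>_def if_True if_False)
  have wv_Cons: "word_value G (relabel \<sigma> ((g, s) # w))
      = (if s then \<sigma> g else inv\<^bsub>G\<^esub> \<sigma> g) \<otimes>\<^bsub>G\<^esub> word_value G (relabel \<sigma> w)" for g s w
    by (simp add: relabel_def word_value_def)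
  have wv: "word_value G (relabel \<sigma> w) = \<phi> (run A w)" for w
  proof (induction w)
    case Nil
    then show ?case by (simp add: relabel_def word_value_def one[unfolded id_def] id_def)
  next
    case (Cons c w)
    obtain g s where c: "c = (g, s)" by (cases c)
    show ?case
      unfolding c wv_Cons letter Cons.IH hom[symmetric] by (simp add: comp_def)
  qed
  have sub: "range \<sigma> \<subseteq> carrier G" by (auto simp: \<sigma>_def carr simp del: run_Cons)
  have gen: "word_value G (relabel \<sigma> w) \<in> generate G (range \<sigma>)" for w
  proof (induction w)
    case Nil
    then show ?case by (simp add: relabel_def word_value_def generate.one)
  next
    case (Cons c w)
    obtain g s where c: "c = (g, s)" by (cases c)
    show ?case
      unfolding c wv_Cons using Cons.IH
      by (auto intro: generate.eng generate.incl generate.inv)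
  qed
  have "generate G (range \<sigma>) = carrier G"
    using G.generate_incl[OF sub] gen by (auto simp: carr wv)
  moreover have "finite (range \<sigma>)" by (simp add: UNIV_gen)
  ultimately have "finite_generating_set G (range \<sigma>)"
    using sub by (simp add: finite_generating_set_def)
  with G inj wv show ?thesis by (blast intro: that)
qed

section \<open>Lower bounds on moves and switches\<close>

abbreviation switches :: "gen word \<Rightarrow> nat" where
  "switches w \<equiv> length (filter (\<lambda>c. fst c = Switch) w)"

abbreviation moves :: "gen word \<Rightarrow> nat" where
  "moves w \<equiv> length (filter (\<lambda>c. fst c = Move) w)"

lemma length_eq_switches_moves: "length w = switches w + moves w"
proof (induction w)
  case (Cons c w)
  then show ?case by (cases "fst c") auto
qed simp

lemma run_position:
  assumes "run A w (k, F, Z) = (k', F', Z')"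
  shows "\<bar>k' - k\<bar> \<le> int (moves w)"
  using assms
proof (induction w arbitrary: k' F' Z')
  case (Cons c w)
  obtain k1 F1 Z1 where 1: "run A w (k, F, Z) = (k1, F1, Z1)" by (cases "run A w (k, F, Z)")
  obtain g s where c: "c = (g, s)" by (cases c)
  show ?case
    using Cons.IH[OF 1] Cons.prems by (cases g) (auto simp: 1 c split: if_splits)
qed simp

text \<open>A lamp changes only when the walk stands at it, so the walk from \<open>k\<close> to
  \<open>k'\<close> passes through \<open>j\<close>.\<close>

lemma run_reach:
  assumes "run A w (k, F, Z) = (k', F', Z')" "F' j \<noteq> F j"
  shows "\<bar>j - k\<bar> + \<bar>k' - j\<bar> \<le> int (moves w)"
  using assms
proof (induction w arbitrary: k' F' Z')
  case (Cons c w)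
  obtain k1 F1 Z1 where 1: "run A w (k, F, Z) = (k1, F1, Z1)" by (cases "run A w (k, F, Z)")
  obtain g s where c: "c = (g, s)" by (cases c)
  show ?case
  proof (cases g)
    case Switch
    then have "k' = k1" "F' = F1(k1 := \<not> F1 k1)" using Cons.prems(1) by (auto simp: 1 c)
    then show ?thesis
      using Cons.IH[OF 1] Cons.prems(2) run_position[OF 1] Switch
      by (cases "j = k1") (simp_all add: c)
  next
    case Move
    then have "F' = F1" "\<bar>k' - k1\<bar> = 1" using Cons.prems(1) by (auto simp: 1 c split: if_splits)
    with Cons.IH[OF 1] Cons.prems(2) Move show ?thesis by (simp add: c)
  qed
qed simp

text \<open>Each switch changes the number of lit lamps by one.\<close>

lemma run_parity:
  assumes "run A w (k, \<lambda>_. False, Z) = (k', F', Z')"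
  shows "finite {j. F' j} \<and> even (card {j. F' j}) = even (switches w)"
  using assms
proof (induction w arbitrary: k' F' Z')
  case (Cons c w)
  obtain k1 F1 Z1 where 1: "run A w (k, \<lambda>_. False, Z) = (k1, F1, Z1)"
    by (cases "run A w (k, \<lambda>_. False, Z)")
  obtain g s where c: "c = (g, s)" by (cases c)
  note IH = Cons.IH[OF 1]
  show ?case
  proof (cases g)
    case Switch
    then have F': "F' = F1(k1 := \<not> F1 k1)" using Cons.prems by (auto simp: 1 c)
    show ?thesis
    proof (cases "F1 k1")
      case True
      then have "{j. F' j} = {j. F1 j} - {k1}" by (auto simp: F')
      moreover have "card {j. F1 j} = Suc (card ({j. F1 j} - {k1}))"
        using IH True by (intro card.remove) auto
      ultimately show ?thesis using IH Switch by (auto simp: c)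
    next
      case False
      then have "{j. F' j} = insert k1 {j. F1 j}" by (auto simp: F')
      with IH False Switch show ?thesis by (simp add: c)
    qed
  next
    case Move
    then show ?thesis using Cons.prems IH by (simp add: 1 c)
  qed
qed simp

lemma run_no_switch:
  "switches w = 0 \<Longrightarrow> \<exists>k'. run A w (k, F, Z) = (k', F, Z)"
proof (induction w)
  case (Cons c w)
  obtain g s where c: "c = (g, s)" by (cases c)
  show ?case using Cons by (cases g) (auto simp: c)
qed simp

text \<open>Here \<open>j\<close> is the place of the only switch. Started with all lamps dark, it
  leaves every exponent unchanged.\<close>

lemma run_one_switch:
  "switches w = 1 \<Longrightarrow>
    \<exists>k' j. run A w (k, F, Z) = (k', F(j := \<not> F j), \<lambda>m. Z m \<noteq> (m \<in> A \<and> F (j + 1 + int m)))"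
proof (induction w)
  case (Cons c w)
  obtain g s where c: "c = (g, s)" by (cases c)
  show ?case
  proof (cases g)
    case Switch
    then have "switches w = 0" using Cons.prems by (simp add: c)
    from run_no_switch[OF this, of A k F Z] obtain k' where "run A w (k, F, Z) = (k', F, Z)" ..
    then have "run A (c # w) (k, F, Z)
        = (k', F(k' := \<not> F k'), \<lambda>m. Z m \<noteq> (m \<in> A \<and> F (k' + 1 + int m)))"
      by (simp add: c Switch)
    then show ?thesis by blast
  next
    case Move
    then have "switches w = 1" using Cons.prems by (simp add: c)
    from Cons.IH[OF this] show ?thesis using Move by (auto simp: c)
  qed
qed simp

section \<open>The probe words and their geodesic lengths\<close>

text \<open>The conjugate of the switch by \<open>n + 1\<close> moves; this distance is the one that
  belongs to \<open>z\<^sub>n\<close>.\<close>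

definition lit :: "nat \<Rightarrow> gen word" where
  "lit n = replicate (Suc n) (Move, False) @ [(Switch, True)] @ replicate (Suc n) (Move, True)"

definition probe :: "nat \<Rightarrow> gen word" where
  "probe n = (Switch, True) # lit n"

lemma run_moves:
  "run A (replicate n (Move, s)) (k, F, Z) = (if s then k + int n else k - int n, F, Z)"
  by (induction n) auto

lemma run_lit:
  "run A (lit n) (k, F, Z) =
    (k, F(k + 1 + int n := \<not> F (k + 1 + int n)),
     \<lambda>m. Z m \<noteq> (m \<in> A \<and> F (k + 1 + int n + 1 + int m)))"
  unfolding lit_def
  by (simp only: run_append run_Cons run_Nil step.simps id_apply comp_apply run_moves
      if_True if_False) (simp add: algebra_simps)

text \<open>The two switches at \<open>k\<close> cancel on the lamps. Between them only lamp
  \<open>k + 1 + n\<close> changes, which could affect only exponent \<open>n\<close>, and that one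
  is frozen.\<close>

lemma run_probe_switch_eq_lit:
  assumes "n \<notin> A"
  shows "run A (probe n @ [(Switch, True)]) = run A (lit n)"
proof
  fix x :: state
  obtain k F Z where x: "x = (k, F, Z)" by (cases x)
  show "run A (probe n @ [(Switch, True)]) x = run A (lit n) x"
    using assms by (auto simp: x probe_def run_lit fun_eq_iff)
qed

lemma length_lit: "length (lit n) = 2 * n + 3"
  by (simp add: lit_def)

lemma length_probe: "length (probe n) = 2 * n + 4"
  by (simp add: probe_def length_lit)

lemma length_ge_probe:
  assumes "run A v = run A (probe n)"
  shows "length (probe n) \<le> length v"
proof -
  let ?F = "(\<lambda>_. False)(1 + int n := True, 0 := True)"
  obtain Z where Z: "run A v (0, \<lambda>_. False, \<lambda>_. False) = (0, ?F, Z)"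
    by (auto simp: assms probe_def run_lit)
  \<comment> \<open>The walk goes from 0 to lamp \<open>n + 1\<close> and back.\<close>
  have "2 * n + 2 \<le> moves v"
    using run_reach[OF Z, of "1 + int n"] by simp
  moreover have "{j. ?F j} = {1 + int n, 0}" by auto
  then have "even (switches v)"
    using run_parity[OF Z] by simp
  moreover have "switches v \<noteq> 0"
  proof
    assume "switches v = 0"
    with run_no_switch[of v A 0 "\<lambda>_. False" "\<lambda>_. False"] have "?F = (\<lambda>_. False)"
      by (simp add: Z)
    from fun_cong[OF this, of 0] show False by simp
  qed
  ultimately have "2 * n + 4 \<le> switches v + moves v"
    by (cases "switches v"; cases "switches v - 1") auto
  then show ?thesis by (simp add: length_probe length_eq_switches_moves[of v])
qed

lemma length_gt_probe:
  assumes "run A v = run A (probe n @ [(Switch, True)])" "n \<in> A"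
  shows "length (probe n) < length v"
proof -
  let ?F = "(\<lambda>_. False)(1 + int n := True)"
  \<comment> \<open>Only the switch performed last sees a lit lamp, namely the one at distance
    \<open>n + 1\<close>.\<close>
  define Z where "Z = (\<lambda>m. m \<in> A \<and> m = n)"
  have "Z n" using assms(2) by (simp add: Z_def)
  have Z: "run A v (0, \<lambda>_. False, \<lambda>_. False) = (0, ?F, Z)"
    unfolding assms(1) by (auto simp: probe_def run_lit fun_eq_iff Z_def)
  have "2 * n + 2 \<le> moves v"
    using run_reach[OF Z, of "1 + int n"] by simp
  moreover have "{j. ?F j} = {1 + int n}" by auto
  then have "odd (switches v)"
    using run_parity[OF Z] by simp
  moreover have "switches v \<noteq> 1"
  proof
    assume "switches v = 1"
    with run_one_switch[of v A 0 "\<lambda>_. False" "\<lambda>_. False"] have "Z = (\<lambda>_. False)"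
      by (simp add: Z)
    with \<open>Z n\<close> show False by simp
  qed
  \<comment> \<open>An odd number other than 1 is at least 3.\<close>
  ultimately have "2 * n + 4 < switches v + moves v"
    by (cases "switches v"; cases "switches v - 1"; cases "switches v - 2") auto
  then show ?thesis by (simp add: length_probe length_eq_switches_moves[of v])
qed

lemma probe_detects:
  fixes G :: "('b, 'c) monoid_scheme" and \<sigma> :: "gen \<Rightarrow> 'b"
  assumes inj: "inj_on \<phi> (range (run A))"
    and wv: "\<And>w. word_value G (relabel \<sigma> w) = \<phi> (run A w)"
  shows "(relabel \<sigma> (probe n), \<sigma> Switch) \<in> valid_inputs G (range \<sigma>)"
    and "ell G (range \<sigma>) (relabel \<sigma> (probe n) @ [(\<sigma> Switch, True)])
           > ell G (range \<sigma>) (relabel \<sigma> (probe n)) \<longleftrightarrow> n \<in> A"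
proof -
  have wv_eq: "word_value G (relabel \<sigma> v) = word_value G (relabel \<sigma> w) \<longleftrightarrow> run A v = run A w"
    for v w using inj by (auto simp: wv inj_on_eq_iff)
  have attained: "\<exists>v. length v = ell G (range \<sigma>) (relabel \<sigma> w) \<and> run A v = run A w" for w
  proof -
    have "relabel \<sigma> w \<in> words (range \<sigma>)" by (simp add: words_range)
    then obtain v' where v': "v' \<in> words (range \<sigma>)" "length v' = ell G (range \<sigma>) (relabel \<sigma> w)"
      "word_value G v' = word_value G (relabel \<sigma> w)"
      by (rule ell_attained)
    then obtain v where "v' = relabel \<sigma> v" by (auto simp: words_range)
    with v' wv_eq show ?thesis by auto
  qed
  have le: "ell G (range \<sigma>) (relabel \<sigma> w) \<le> length v" if "run A v = run A w" for v w
    using ell_le[of "relabel \<sigma> v" "range \<sigma>" G "relabel \<sigma> w"] that by (simp add: words_range wv_eq)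
  have ell_probe: "ell G (range \<sigma>) (relabel \<sigma> (probe n)) = length (probe n)"
    using attained[of "probe n"] le[OF refl, of "probe n"] length_ge_probe[of A _ n]
    by (metis le_antisym)
  then show "(relabel \<sigma> (probe n), \<sigma> Switch) \<in> valid_inputs G (range \<sigma>)"
    by (simp add: valid_inputs_def geodesic_def words_range)
  have app: "relabel \<sigma> (probe n) @ [(\<sigma> Switch, True)] = relabel \<sigma> (probe n @ [(Switch, True)])"
    by (simp add: relabel_def)
  show "ell G (range \<sigma>) (relabel \<sigma> (probe n) @ [(\<sigma> Switch, True)])
           > ell G (range \<sigma>) (relabel \<sigma> (probe n)) \<longleftrightarrow> n \<in> A"
  proof (cases "n \<in> A")
    case True
    with attained[of "probe n @ [(Switch, True)]"] length_gt_probe[of A _ n] show ?thesis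
      unfolding app ell_probe by metis
  next
    case False
    \<comment> \<open>\<open>lit n\<close> is a representative one letter shorter than the
      probe.\<close>
    with le[OF run_probe_switch_eq_lit[OF False, symmetric]] show ?thesis
      unfolding app ell_probe by (simp add: length_probe length_lit)
  qed
qed

section \<open>Encodings and diagonalisation\<close>

text \<open>Refers only to the numbers of the two generators, not to the group. The set
  \<open>A\<close> can thus be defined from program outputs before the group that depends on it
  exists.\<close>

definition encode_gen_input :: "nat \<times> nat \<Rightarrow> gen word \<Rightarrow> nat list" where
  "encode_gen_input ab w =
     (let \<nu> = case_gen (fst ab) (snd ab)
      in [list_encode (map (\<lambda>(g, s). prod_encode (\<nu> g, of_bool s)) w), \<nu> Switch])"

lemma encode_input_relabel:
  "encode_input num (relabel \<sigma> w, \<sigma> Switch)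
     = encode_gen_input (num (\<sigma> Switch), num (\<sigma> Move)) w"
proof -
  have "case_gen (num (\<sigma> Switch)) (num (\<sigma> Move)) g = num (\<sigma> g)" for g
    by (cases g) simp_all
  then show ?thesis
    by (simp add: encode_gen_input_def encode_input_def encode_word_def relabel_def Let_def
        comp_def case_prod_unfold)
qed

text \<open>
  A triple \<open>(b, p, ab)\<close> stands for a problem, a program and the numbers of the two generators.
\<close>

definition decides :: "bool \<times> recf \<times> nat \<times> nat \<Rightarrow> nat \<Rightarrow> bool" where
  "decides = (\<lambda>(b, p, ab) n. \<exists>y. halts_with p (encode_gen_input ab (probe n)) y \<and>
     (if b then int_decode y > 0 else y = 1))"

text \<open>Determinism makes the output in \<open>decides\<close> the given
  \<open>y\<close>.\<close>

lemma decides_iff: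
  assumes "halts_with p (encode_gen_input ab (probe n)) y"
  shows "decides (b, p, ab) n \<longleftrightarrow> (if b then int_decode y > 0 else y = 1)"
proof -
  have "halts_with p (encode_gen_input ab (probe n)) z \<longleftrightarrow> z = y" for z
    using assms halts_with_deterministic by blast
  then show ?thesis by (simp add: decides_def)
qed

theorem mainTheorem5:
  "\<exists>(G :: nat monoid) S.
     group G \<and> finite_generating_set G S \<and>
     \<not> solvable_for_generators G S (problem1_answer G S) \<and>
     \<not> solvable_for_generators G S (problem2_answer G S)"
proof -
  \<comment> \<open>Differs at \<open>n\<close> from the set decided by the triple with code
    \<open>n\<close>.\<close>
  define A where "A = {n. \<not> decides (from_nat n) n}"
  have diagonal: "\<exists>n. decides c n \<noteq> (n \<in> A)" for c
    by (rule exI[of _ "to_nat c"]) (simp add: A_def)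
  obtain G :: "nat monoid" and \<sigma> \<phi> where G: "group G" "finite_generating_set G (range \<sigma>)"
    and inj: "inj_on \<phi> (range (run A))"
    and wv: "\<And>w. word_value G (relabel \<sigma> w) = \<phi> (run A w)"
    by (rule lamp_group_on_nat[of A]) (blast intro: that)
  note probe = probe_detects[OF inj wv]
  \<comment> \<open>The flag \<open>b\<close> selects how an answer is read: as an encoded
    difference to be tested for positivity, or as a truth value.\<close>
  have unsolvable: "\<not> solvable_for_generators G (range \<sigma>) answer"
    if answer: "\<And>n. (let y = answer (relabel \<sigma> (probe n), \<sigma> Switch)
                    in if b then int_decode y > 0 else y = 1) \<longleftrightarrow> n \<in> A" for b answer
  proof
    assume "solvable_for_generators G (range \<sigma>) answer"
    then obtain num p where
      p: "\<And>i. i \<in> valid_inputs G (range \<sigma>) \<Longrightarrow> halts_with p (encode_input num i) (answer i)"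
      unfolding solvable_for_generators_def algorithmically_solvable_def by blast
    define ab where "ab = (num (\<sigma> Switch), num (\<sigma> Move))"
    have "decides (b, p, ab) n \<longleftrightarrow> n \<in> A" for n
    proof -
      have "halts_with p (encode_gen_input ab (probe n)) (answer (relabel \<sigma> (probe n), \<sigma> Switch))"
        using p[OF probe(1)[of n]] by (simp only: encode_input_relabel ab_def)
      from decides_iff[OF this] answer[of n] show ?thesis by (simp only: Let_def)
    qed
    with diagonal show False by blast
  qed
  have "\<not> solvable_for_generators G (range \<sigma>) (problem1_answer G (range \<sigma>))"
    by (rule unsolvable[of _ True]) (use probe(2) in \<open>simp add: problem1_answer_def\<close>)
  moreover have "\<not> solvable_for_generators G (range \<sigma>) (problem2_answer G (range \<sigma>))"
    by (rule unsolvable[of _ False]) (use probe(2) in \<open>simp add: problem2_answer_def\<close>)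
  ultimately show ?thesis using G by blast
qed

end
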